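(* Let $\nabla_m(z)=\sum_{k=0}^{\lfloor m/2\rfloor}c_{m-2k}z^{m-2k}$ be the Conway polynomial, of degree $m$, of a two-bridge link (or knot). Let $g\ge1$ be the greatest prime divisor of $c_m$ (with $g=1$ if $|c_m|=1$), and let $k$ be an integer with $m\ge 2k\ge 2$. Then $$|c_{m-2k}|\le\left(\binom{m-k-1}{k}+\frac1g\left(\binom{m-k-1}{k-1}-1\right)\right)|c_m|+1.$$ Equality holds for the links of Conway forms $C(2g,2,2,\dots,2)$ and $C(2g,-2,2,\dots,(-1)^{m+1}2)$ (with $m$ entries, $g$ being $1$ or a prime).
   Context: Extended Euler continuant polynomials: for integers $b_1,\dots,b_m$, $D_m(b_1,\dots,b_m)(z)$ is defined by $D_{-1}=0$, $D_0=1$, $D_k=b_k z D_{k-1}+D_{k-2}$. Two-bridge links: for nonzero integers $b_1,\dots,b_m$ ($m\ge 0$), $C(2b_1,-2b_2,\dots,(-1)^{m-1}2b_m)$ denotes the two-bridge link in Conway normal form with these numbers of signed crossings in its successive twist regions (its Schubert fraction is the continued fraction $[2b_1,-2b_2,\dots,(-1)^{m-1}2b_m]$, where $[a_1,\dots,a_n]=a_1+1/(a_2+1/(\cdots+1/a_n))$), oriented so that the two strands of each twist region are antiparallel (it bounds the linear plumbing of $m$ unknotted annuli with $|b_1|,\dots,|b_m|$ full twists). Every oriented two-bridge link is of this form. The Conway polynomial of an oriented link is defined by $\nabla_{\text{unknot}}=1$ and $\nabla_{L_+}-\nabla_{L_-}=z\nabla_{L_0}$. It is known (Siebenmann; Cromwell)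 that the Conway polynomial of $C(2b_1,-2b_2,\dots,(-1)^{m-1}2b_m)$ is $D_m(b_1,\dots,b_m)(z)$; in particular it has degree $m$ and leading coefficient $c_m=b_1\cdots b_m$. Binomial coefficients $\binom{a}{b}$ with $b>a\ge 0$ are $0$. *)

theory Defs
  imports Complex_Main "HOL-Computational_Algebra.Computational_Algebra"
begin

section \<open>Oriented link diagrams\<close>

text \<open>
  Oriented links are represented by plane diagrams in Morse position, read from bottom to top
  as a finite sequence of elementary events.  At each height the diagram meets a horizontal line
  in finitely many strands, numbered from the left starting at 0; the list of their orientations
  (\<open>True\<close> is upwards, \<open>False\<close> is downwards) is the state at that height.  An event is a kind
  together with the number of the leftmost strand position it involves:
  \<^item> \<open>Cup u\<close>: a local minimum; its left leg is oriented upwards iff \<open>u\<close>.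
  \<^item> \<open>Cap\<close>: a local maximum, joining two neighbouring strands of opposite orientation.
  \<^item> \<open>Cross ov\<close>: two neighbouring strands cross; the one running from bottom left to top right
    is the overcrossing one iff \<open>ov\<close>.
\<close>

datatype kind = Cup bool | Cap | Cross bool

type_synonym event = "kind \<times> nat"
type_synonym diagram = "event list"

fun act :: "bool list \<Rightarrow> event \<Rightarrow> bool list option" where
  "act w (Cup u, i) =
     (if i \<le> length w then Some (take i w @ [u, \<not> u] @ drop i w) else None)"
| "act w (Cap, i) =
     (if i + 1 < length w \<and> w ! i \<noteq> w ! (i + 1)
      then Some (take i w @ drop (i + 2) w) else None)"
| "act w (Cross ov, i) =
     (if i + 1 < length w
      then Some (take i w @ [w ! (i + 1), w ! i] @ drop (i + 2) w) else None)"

fun run :: "bool list \<Rightarrow> diagram \<Rightarrow> bool list option" where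
  "run w [] = Some w"
| "run w (e # D) = (case act w e of None \<Rightarrow> None | Some w' \<Rightarrow> run w' D)"

definition link_diagram :: "diagram \<Rightarrow> bool" where
  "link_diagram D \<longleftrightarrow> run [] D = Some []"

fun n_in :: "kind \<Rightarrow> nat" where
  "n_in (Cup u) = 0" | "n_in Cap = 2" | "n_in (Cross ov) = 2"

fun n_out :: "kind \<Rightarrow> nat" where
  "n_out (Cup u) = 2" | "n_out Cap = 0" | "n_out (Cross ov) = 2"

text \<open>
  The standard local moves for tangle diagrams in Morse position (Turaev, Freyd--Yetter): planar
  isotopy together with the Reidemeister moves.  Two oriented link diagrams represent isotopic
  oriented links iff they are related by finitely many of them.
  \<open>commute\<close> exchanges the heights of two events that are horizontally disjoint; the index of the
  right one is adapted to the number of strands that the left one adds or removes.  In \<open>R3\<close> the side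
  condition says that one of the three strands lies above the two others and one below,
  which excludes exactly the cyclic configurations.
\<close>

inductive move :: "diagram \<Rightarrow> diagram \<Rightarrow> bool" where
  commute: "i \<le> j \<Longrightarrow> move [(X, i), (Y, j + n_out X)] [(Y, j + n_in X), (X, i)]"
| zigzag_left: "move [(Cup u, i + 1), (Cap, i)] []"
| zigzag_right: "move [(Cup u, i), (Cap, i + 1)] []"
| slide_cup: "move [(Cup u, i), (Cross a, i + 1)] [(Cup u, i + 1), (Cross (\<not> a), i)]"
| slide_cap: "move [(Cross a, i), (Cap, i + 1)] [(Cross (\<not> a), i + 1), (Cap, i)]"
| R1_cup: "move [(Cup u, i), (Cross a, i)] [(Cup (\<not> u), i)]"
| R1_cap: "move [(Cross a, i), (Cap, i)] [(Cap, i)]"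
| R2: "move [(Cross a, i), (Cross (\<not> a), i)] []"
| R3: "b = a \<or> b = c \<Longrightarrow>
    move [(Cross a, i), (Cross b, i + 1), (Cross c, i)]
         [(Cross c, i + 1), (Cross b, i), (Cross a, i + 1)]"

definition step :: "diagram \<Rightarrow> diagram \<Rightarrow> bool" where
  "step D E \<longleftrightarrow> link_diagram D \<and> link_diagram E \<and>
     (\<exists>A X Y B. D = A @ X @ B \<and> E = A @ Y @ B \<and> move X Y)"

definition isotopic :: "diagram \<Rightarrow> diagram \<Rightarrow> bool" where
  "isotopic = equivclp step"

section \<open>The Conway polynomial\<close>

definition unknot :: diagram where
  "unknot = [(Cup True, 0), (Cap, 0)]"

text \<open>
  For a crossing of parallel strands (both upwards or both downwards) the sign is positive iff
  the strand from bottom left to top right is above, and the oriented smoothing consists of two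
  vertical strands.  For antiparallel strands the sign rule is reversed, and the oriented
  smoothing is a cap followed by a cup.
\<close>

inductive skein_triple :: "diagram \<Rightarrow> diagram \<Rightarrow> diagram \<Rightarrow> bool" where
  parallel:
    "run [] A = Some w \<Longrightarrow> i + 1 < length w \<Longrightarrow> w ! i = w ! (i + 1) \<Longrightarrow>
     link_diagram (A @ [(Cross True, i)] @ B) \<Longrightarrow>
     skein_triple (A @ [(Cross True, i)] @ B) (A @ [(Cross False, i)] @ B) (A @ B)"
| antiparallel:
    "run [] A = Some w \<Longrightarrow> i + 1 < length w \<Longrightarrow> w ! i \<noteq> w ! (i + 1) \<Longrightarrow>
     link_diagram (A @ [(Cross False, i)] @ B) \<Longrightarrow>
     skein_triple (A @ [(Cross False, i)] @ B) (A @ [(Cross True, i)] @ B)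
       (A @ [(Cap, i), (Cup (w ! (i + 1)), i)] @ B)"

text \<open>
  By a theorem of Conway there is exactly one such function on oriented links; its values on
  lists that are not link diagrams are irrelevant.
\<close>

definition is_conway_polynomial :: "(diagram \<Rightarrow> int poly) \<Rightarrow> bool" where
  "is_conway_polynomial N \<longleftrightarrow>
     (\<forall>D E. link_diagram D \<and> link_diagram E \<and> isotopic D E \<longrightarrow> N D = N E) \<and>
     N unknot = 1 \<and>
     (\<forall>Lp Lm L0. skein_triple Lp Lm L0 \<longrightarrow> N Lp - N Lm = [:0, 1:] * N L0)"

section \<open>Two-bridge links\<close>

text \<open>
  Conway's normal form \<open>C(a\<^sub>1, \<dots>, a\<^sub>m)\<close> as a plat on four strands: \<open>\<bar>a\<^sub>j\<bar>\<close> crossings, alternately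
  between the two middle strands (\<open>j\<close> odd) and between the two left strands (\<open>j\<close> even).  The
  diagram is alternating if all \<open>a\<^sub>j\<close> have the same sign, so the crossings of the two kinds carry
  opposite conventions.  In the code the index \<open>j\<close> starts at 0.

  All numbers are even in the forms considered here.  Starting with two cups of the same
  orientation \<open>u\<close>, the state is then \<open>u, \<not> u, u, \<not> u\<close> below and above each twist
  region, so the two strands of each region are antiparallel.  The two choices of \<open>u\<close> differ by
  reversing all components.  With the numbers \<open>2b\<^sub>1, -2b\<^sub>2, \<dots>\<close>, the crossings of region \<open>j\<close> have
  the sign of \<open>b\<^sub>j\<close> as oriented crossings; for \<open>m = 1\<close> the linking number is \<open>b\<^sub>1\<close>.
\<close>

definition twist_region :: "nat \<Rightarrow> int \<Rightarrow> diagram" where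
  "twist_region j a =
     replicate (nat \<bar>a\<bar>) (if even j then (Cross (a < 0), 1) else (Cross (a > 0), 0))"

definition conway_form :: "bool \<Rightarrow> int list \<Rightarrow> diagram" where
  "conway_form u as =
     [(Cup u, 0), (Cup u, 2)] @
     concat (map (\<lambda>j. twist_region j (as ! j)) [0..<length as]) @
     (if even (length as) then [(Cap, 1), (Cap, 0)] else [(Cap, 0), (Cap, 0)])"

definition is_C :: "diagram \<Rightarrow> int list \<Rightarrow> bool" where
  "is_C L as \<longleftrightarrow> link_diagram L \<and> (\<exists>u. isotopic L (conway_form u as))"

definition two_bridge :: "diagram \<Rightarrow> bool" where
  "two_bridge L \<longleftrightarrow>
     (\<exists>bs. 0 \<notin> set bs \<and> is_C L (map (\<lambda>j. (-1) ^ j * (2 * bs ! j)) [0..<length bs]))"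

definition greatest_prime_divisor :: "int \<Rightarrow> nat" where
  "greatest_prime_divisor c = (if \<bar>c\<bar> = 1 then 1 else Max {p. prime p \<and> int p dvd c})"

end

theory Submission
  imports Defs
begin

text \<open>
  \<^bold>\<open>The Conway polynomial.\<close>  In the diagram of the form \<open>C(2b\<^sub>1, -2b\<^sub>2, \<dots>)\<close>, change one
  crossing of the last twist region: the changed crossing cancels against its neighbour, which
  replaces \<open>b\<^sub>m\<close> by \<open>b\<^sub>m \<mp> 1\<close>, while the oriented smoothing cuts the last band,
  after which the remaining crossings of the region are kinks and the diagram of the
  first \<open>m - 1\<close> regions is left.  After \<open>\<bar>b\<^sub>m\<bar>\<close> such changes (\<open>conway_full_twists\<close>) the last
  region is empty, the region before it untwists at the maxima that close the plat, and the
  diagram of the first \<open>m - 2\<close> regions appears.  This is the recursion of the continuant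
  (\<open>conway_plat\<close>).

  \<^bold>\<open>The coefficients.\<close>  By Euler's rule, the coefficient of \<open>z\<close> to the power \<open>m - 2k\<close> in the
  continuant is the sum, over the ways to delete \<open>k\<close> disjoint pairs of neighbours from
  \<open>b\<^sub>1, \<dots>, b\<^sub>m\<close>, of the product of the remaining entries (\<open>coeff_continuant\<close>).  A
  deletion is recorded by the set \<open>C\<close> of deleted indices.  There are \<open>m - k\<close> choose \<open>k\<close> such
  sets, and at most \<open>m - k - 1\<close> choose \<open>k\<close> of them avoid a given index \<open>j\<close>, with equality
  if \<open>j\<close> is the first one.

  \<^bold>\<open>The inequality.\<close>  The number \<open>g\<close>, a prime or 1, divides some \<open>b\<^sub>j\<close>; write
  \<open>\<bar>c\<^sub>m\<bar> = g h\<close>.  The absolute value of the term of a set \<open>C\<close> is at most \<open>h\<close> if \<open>j\<close> is in \<open>C\<close>,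
  and at most \<open>g h\<close> otherwise; by the above counts, the sum of these estimates exceeds the asserted
  bound by at most \<open>h - 1\<close>.  To gain \<open>h - 1\<close>, let \<open>Q C\<close> be the product of the \<open>\<bar>b\<^sub>i\<bar>\<close> with \<open>i\<close> in \<open>C\<close>, where \<open>b\<^sub>j\<close> is replaced by \<open>b\<^sub>j / g\<close>.  The
  term of \<open>C\<close> in fact stays below the estimate by at least \<open>h (1 - 1 / Q C)\<close>.  The
  counts above show that every index lies in some \<open>C\<close>, so the product of all \<open>Q C\<close> is at
  least \<open>h\<close>, and Weierstrass' product inequality gives a total gain of at least
  \<open>h (1 - 1 / h) = h - 1\<close> (\<open>cover_sum_bound\<close>).

  \<^bold>\<open>Sharpness.\<close>  For \<open>b = (g, e, e\<^sup>2, \<dots>)\<close> with \<open>e = \<plusminus>1\<close> all terms have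
  the same sign, because deleting two neighbours always divides the sign by \<open>e\<close>.  So the absolute
  value of the coefficient is \<open>g\<close> times the number of sets that avoid the first index plus the
  number of sets that contain it (\<open>continuant_extremal\<close>).
\<close>

section \<open>Local moves on diagrams and the Conway polynomial\<close>

lemma run_append: "run w (A @ B) = Option.bind (run w A) (\<lambda>v. run v B)"
  by (induction A arbitrary: w) (auto split: option.splits)

text \<open>
  Writing the state as a concatenation that exhibits the affected strands keeps index arithmetic
  out of what follows.  The left-hand sides match only as long as \<open>append_Cons\<close> does not
  normalise them.
\<close>

lemma act_Cross [simp]:
  "act (w1 @ [x, y] @ w2) (Cross a, length w1) = Some (w1 @ [y, x] @ w2)"
  by (simp add: nth_append)

lemma act_Cup [simp]: "act (w1 @ w2) (Cup x, length w1) = Some (w1 @ [x, \<not> x] @ w2)"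
  by simp

lemma act_Cap [simp]: "x \<noteq> y \<Longrightarrow> act (w1 @ [x, y] @ w2) (Cap, length w1) = Some (w1 @ w2)"
  by (simp add: nth_append)

declare act.simps [simp del]

lemma run_even_crossings:
  "run (w1 @ [x, y] @ w2) (replicate (2 * n) (Cross a, length w1)) = Some (w1 @ [x, y] @ w2)"
proof (induction n)
  case 0
  show ?case by simp
next
  case (Suc n)
  then show ?case
    using act_Cross[of w1 x y w2 a] act_Cross[of w1 y x w2 a] by simp
qed

lemma conway_move:
  assumes N: "is_conway_polynomial N" and mv: "move X Y"
    and "run [] A = Some w" "run w X = Some v" "run w Y = Some v" "run v B = Some []"
  shows "N (A @ X @ B) = N (A @ Y @ B)"
proof -
  have l: "link_diagram (A @ X @ B)" "link_diagram (A @ Y @ B)"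
    using assms by (simp_all add: link_diagram_def run_append)
  then have "step (A @ X @ B) (A @ Y @ B)"
    using mv unfolding step_def by blast
  then have "isotopic (A @ X @ B) (A @ Y @ B)"
    unfolding isotopic_def by (rule r_into_equivclp)
  then show ?thesis
    using N l unfolding is_conway_polynomial_def by blast
qed

text \<open>
  Crossings just below a maximum, or just above a minimum, are kinks.  Only their effect on the
  orientations remains: each crossing above a minimum reverses the orientation of its left leg.
\<close>

lemma conway_kinks_below_cap:
  assumes N: "is_conway_polynomial N" and A: "run [] A = Some (w1 @ [x, \<not> x] @ w2)"
    and B: "run (w1 @ w2) B = Some []"
  shows "N (A @ replicate n (Cross a, length w1) @ [(Cap, length w1)] @ B)
       = N (A @ [(Cap, length w1)] @ B)"
  using A
proof (induction n arbitrary: A x)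
  case 0
  show ?case by simp
next
  case (Suc n)
  let ?X = "(Cross a, length w1)" and ?Cap = "(Cap, length w1)"
  have "run [] (A @ [?X]) = Some (w1 @ [\<not> x, \<not> \<not> x] @ w2)"
    using Suc.prems by (simp add: run_append del: append_Cons)
  from Suc.IH[OF this]
  have "N (A @ replicate (Suc n) ?X @ [?Cap] @ B) = N (A @ [?X, ?Cap] @ B)"
    by simp
  also have "\<dots> = N (A @ [?Cap] @ B)"
    by (rule conway_move[OF N move.R1_cap Suc.prems _ _ B]) (simp_all del: append_Cons)
  finally show ?case .
qed

lemma conway_kinks_above_cup:
  assumes N: "is_conway_polynomial N" and A: "run [] A = Some (w1 @ w2)"
    and B: "run (w1 @ [x = even n, x \<noteq> even n] @ w2) B = Some []"
  shows "N (A @ [(Cup x, length w1)] @ replicate n (Cross a, length w1) @ B)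
       = N (A @ [(Cup (x = even n), length w1)] @ B)"
  using B
proof (induction n arbitrary: x)
  case 0
  show ?case by simp
next
  case (Suc n)
  let ?X = "(Cross a, length w1)"
  have B': "run (w1 @ [\<not> x, x] @ w2) (replicate n ?X @ B) = Some []"
  proof -
    have "run (w1 @ [y, \<not> y] @ w2) (replicate n ?X @ B) = run (w1 @ [y = even n, y \<noteq> even n] @ w2) B" for y
    proof (induction n arbitrary: y)
      case (Suc n)
      have *: "replicate (Suc n) ?X @ B = ?X # replicate n ?X @ B" by simp
      show ?case
        unfolding * using Suc.IH[of "\<not> y"] act_Cross[of w1 y "\<not> y" w2 a]
        by (cases y; cases "even n") (simp_all del: append_Cons)
    qed simp
    from this[of "\<not> x"] Suc.prems show ?thesis
      by (cases x; cases "even n") (simp_all del: append_Cons)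
  qed
  have "N (A @ [(Cup x, length w1)] @ replicate (Suc n) ?X @ B)
      = N (A @ [(Cup x, length w1), ?X] @ replicate n ?X @ B)" by simp
  also have "\<dots> = N (A @ [(Cup (\<not> x), length w1)] @ replicate n ?X @ B)"
    by (rule conway_move[OF N move.R1_cup A _ _ B']) (simp_all del: append_Cons)
  also have "\<dots> = N (A @ [(Cup (x = even (Suc n)), length w1)] @ B)"
    using Suc.IH[of "\<not> x"] Suc.prems by (cases x; cases "even n") (simp_all del: append_Cons)
  finally show ?case .
qed

lemma conway_crossing_change:
  assumes N: "is_conway_polynomial N" and A: "run [] A = Some (w1 @ [x, \<not> x] @ w2)"
    and B: "run (w1 @ [\<not> x, x] @ w2) B = Some []"
  shows "N (A @ [(Cross False, length w1)] @ B) - N (A @ [(Cross True, length w1)] @ B)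
       = [:0, 1:] * N (A @ [(Cap, length w1), (Cup (\<not> x), length w1)] @ B)"
proof -
  let ?w = "w1 @ [x, \<not> x] @ w2" and ?p = "length w1"
  have "link_diagram (A @ [(Cross False, ?p)] @ B)"
    using A B by (simp add: link_diagram_def run_append del: append_Cons)
  with A have "skein_triple (A @ [(Cross False, ?p)] @ B) (A @ [(Cross True, ?p)] @ B)
      (A @ [(Cap, ?p), (Cup (?w ! (?p + 1)), ?p)] @ B)"
    by (intro skein_triple.antiparallel) (auto simp: nth_append)
  then have "skein_triple (A @ [(Cross False, ?p)] @ B) (A @ [(Cross True, ?p)] @ B)
      (A @ [(Cap, ?p), (Cup (\<not> x), ?p)] @ B)"
    by (simp add: nth_append)
  then show ?thesis
    using N unfolding is_conway_polynomial_def by blast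
qed

definition full_twists :: "nat \<Rightarrow> int \<Rightarrow> diagram" where
  "full_twists p b = replicate (2 * nat \<bar>b\<bar>) (Cross (b < 0), p)"

text \<open>
  Each full twist is undone by changing its first crossing, which then cancels against the
  second one.  The smoothing of that first crossing is a maximum followed by a minimum, and the
  remaining odd number of crossings of the region are kinks above this minimum, so that the
  smoothed diagram is the same for all full twists.
\<close>

lemma conway_full_twists:
  assumes N: "is_conway_polynomial N" and A: "run [] A = Some (w1 @ [x, \<not> x] @ w2)"
    and B: "run (w1 @ [x, \<not> x] @ w2) B = Some []"
  shows "N (A @ full_twists (length w1) b @ B)
       = N (A @ B) + [:0, b:] * N (A @ [(Cap, length w1), (Cup x, length w1)] @ B)"
proof -
  let ?p = "length w1"
  let ?L0 = "N (A @ [(Cap, ?p), (Cup x, ?p)] @ B)"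
  have *: "N (A @ replicate (2 * n) (Cross s, ?p) @ B)
      = N (A @ B) + [:0, if s then - int n else int n:] * ?L0" for n s
  proof (induction n)
    case 0
    show ?case by simp
  next
    case (Suc n)
    let ?X = "(Cross s, ?p)"
    let ?B = "replicate (2 * n) ?X @ B"
    have rB: "run (w1 @ [x, \<not> x] @ w2) ?B = Some []"
      using B by (simp add: run_append run_even_crossings del: append_Cons)
    \<comment> \<open>\<open>2 n + 1\<close> kinks remain, so the minimum changes its orientation from \<open>\<not> x\<close> to \<open>x\<close>.\<close>
    have "N (A @ [(Cap, ?p), (Cup (\<not> x), ?p)] @ ?X # ?B)
        = N ((A @ [(Cap, ?p)]) @ [(Cup (\<not> x), ?p)] @ replicate (Suc (2 * n)) ?X @ B)"
      by simp
    also have "\<dots> = N ((A @ [(Cap, ?p)]) @ [(Cup ((\<not> x) = even (Suc (2 * n))), ?p)] @ B)"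
      using A B by (intro conway_kinks_above_cup[OF N, where ?w2.0 = w2])
        (simp_all add: run_append del: append_Cons)
    finally have smooth: "N (A @ [(Cap, ?p), (Cup (\<not> x), ?p)] @ ?X # ?B) = ?L0" by simp
    have "N (A @ [(Cross (\<not> s), ?p), (Cross (\<not> \<not> s), ?p)] @ ?B) = N (A @ [] @ ?B)"
      by (rule conway_move[OF N move.R2 A _ _ rB]) (simp_all del: append_Cons)
    then have change: "N (A @ [(Cross (\<not> s), ?p)] @ ?X # ?B) = N (A @ ?B)"
      by simp
    have "N (A @ [(Cross False, ?p)] @ ?X # ?B) - N (A @ [(Cross True, ?p)] @ ?X # ?B)
        = [:0, 1:] * ?L0"
      using rB unfolding smooth[symmetric]
      by (intro conway_crossing_change[OF N A]) (simp del: append_Cons)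
    with change have "N (A @ ?X # ?X # ?B) = N (A @ ?B) + [:0, if s then - 1 else 1:] * ?L0"
      by (cases s) (simp_all add: algebra_simps)
    then show ?case
      using Suc.IH by (cases s) (simp_all add: algebra_simps smult_add_left smult_diff_left)
  qed
  show ?thesis
    unfolding full_twists_def * by simp
qed

section \<open>The Conway polynomial of a two-bridge link\<close>

definition region_pos :: "nat \<Rightarrow> nat" where
  "region_pos j = (if even j then 1 else 0)"

text \<open>
  Below the maxima that close it, the diagram of the form with \<open>m\<close> regions is an initial part
  of the one with \<open>m + 1\<close> regions; the position of these maxima depends on the parity of \<open>m\<close>
  only.  The recursion combines bottoms and tops of different parity.
\<close>

definition plat_bottom :: "bool \<Rightarrow> (nat \<Rightarrow> int) \<Rightarrow> nat \<Rightarrow> diagram" where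
  "plat_bottom u b m =
     [(Cup u, 0), (Cup u, 2)] @ concat (map (\<lambda>j. full_twists (region_pos j) (b j)) [0..<m])"

definition plat_top :: "nat \<Rightarrow> diagram" where
  "plat_top m = (if even m then [(Cap, 1), (Cap, 0)] else [(Cap, 0), (Cap, 0)])"

lemma conway_form_plat:
  "conway_form u (map (\<lambda>j. (-1) ^ j * (2 * b j)) [0..<m]) = plat_bottom u b m @ plat_top m"
proof -
  have "twist_region j ((-1) ^ j * (2 * b j)) = full_twists (region_pos j) (b j)" for j
    by (simp add: twist_region_def full_twists_def region_pos_def abs_mult nat_mult_distrib)
  then have "map (\<lambda>j. twist_region j (map (\<lambda>j. (-1) ^ j * (2 * b j)) [0..<m] ! j)) [0..<m]
      = map (\<lambda>j. full_twists (region_pos j) (b j)) [0..<m]"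
    by (intro map_cong) auto
  then show ?thesis
    by (simp only: conway_form_def plat_bottom_def plat_top_def length_map length_upt diff_zero
        append_assoc)
qed

lemma plat_bottom_Suc:
  "plat_bottom u b (Suc m) = plat_bottom u b m @ full_twists (region_pos m) (b m)"
  by (simp add: plat_bottom_def)

text \<open>
  The two strands of region \<open>j\<close> are antiparallel, and joining them leaves the state of a single
  minimum.
\<close>

lemma plat_state_split:
  obtains w1 x w2 where "[u, \<not> u, u, \<not> u] = w1 @ [x, \<not> x] @ w2" "length w1 = region_pos j"
    "x = (u = odd j)" "w1 @ w2 = [u, \<not> u]"
proof (cases "even j")
  case True
  show ?thesis
    by (rule that[of "[u]" "\<not> u" "[\<not> u]"]) (simp_all add: region_pos_def True)
next
  case False
  show ?thesis
    by (rule that[of "[]" u "[u, \<not> u]"]) (simp_all add: region_pos_def False)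
qed

lemma run_full_twists:
  "run [u, \<not> u, u, \<not> u] (full_twists (region_pos j) b) = Some [u, \<not> u, u, \<not> u]"
proof -
  obtain w1 x w2 where w: "[u, \<not> u, u, \<not> u] = w1 @ [x, \<not> x] @ w2" "length w1 = region_pos j"
    by (rule plat_state_split)
  show ?thesis
    unfolding full_twists_def w(1) w(2)[symmetric] by (rule run_even_crossings)
qed

lemma run_plat_bottom: "run [] (plat_bottom u b m) = Some [u, \<not> u, u, \<not> u]"
proof (induction m)
  case 0
  then show ?case by (simp add: plat_bottom_def act.simps)
next
  case (Suc m)
  then show ?case by (simp add: plat_bottom_Suc run_append run_full_twists)
qed

lemma run_plat_top: "run [u, \<not> u, u, \<not> u] (plat_top m) = Some []"
  by (simp add: plat_top_def act.simps)

text \<open>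
  A kinked circle can be simplified by removing the kink at its minimum or at its maximum; the two
  results have opposite orientations.
\<close>

lemma conway_circle:
  assumes N: "is_conway_polynomial N"
  shows "N [(Cup u, 0), (Cap, 0)] = 1"
proof -
  have flip: "N [(Cup True, 0), (Cross True, 0), (Cap, 0)] = N [(Cup False, 0), (Cap, 0)]"
    using conway_move[OF N move.R1_cup[of True 0 True], of "[]" "[]" "[False, True]" "[(Cap, 0)]"]
    by (simp add: act.simps)
  have "N [(Cup True, 0), (Cross True, 0), (Cap, 0)] = N [(Cup True, 0), (Cap, 0)]"
    using conway_move[OF N move.R1_cap[of True 0], of "[(Cup True, 0)]" "[True, False]" "[]" "[]"]
    by (simp add: act.simps)
  with flip have "N [(Cup u, 0), (Cap, 0)] = N unknot"
    by (cases u) (simp_all add: unknot_def)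
  then show ?thesis
    using N by (simp add: is_conway_polynomial_def)
qed

text \<open>
  The two ways to put a kink into a circle give the same link, hence the smoothing of the kink,
  which is the split union of two circles, has polynomial 0.
\<close>

lemma conway_two_circles:
  assumes N: "is_conway_polynomial N"
  shows "N [(Cup u, 0), (Cup u, 2), (Cap, 0), (Cap, 0)] = 0"
proof -
  let ?k = "\<lambda>a. [(Cup (\<not> u), 0), (Cross a, 0), (Cap, 0)]"
  let ?L0 = "[(Cup (\<not> u), 0), (Cap, 0), (Cup u, 0), (Cap, 0)]"
  have kink: "N (?k a) = 1" for a
    using conway_kinks_below_cap[OF N, of "[(Cup (\<not> u), 0)]" "[]" "\<not> u" "[]" "[]" 1 a]
      conway_circle[OF N, of "\<not> u"]
    by (simp add: act.simps)
  have "N (?k False) - N (?k True) = [:0, 1:] * N ?L0"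
    using conway_crossing_change[OF N, of "[(Cup (\<not> u), 0)]" "[]" "\<not> u" "[]" "[(Cap, 0)]"]
    by (simp add: act.simps)
  then have L0: "N ?L0 = 0"
    by (simp add: kink)
  have "N ?L0 = N [(Cup (\<not> u), 0), (Cross True, 0), (Cap, 0), (Cup u, 0), (Cap, 0)]"
    using conway_kinks_below_cap[OF N, of "[(Cup (\<not> u), 0)]" "[]" "\<not> u" "[]" "[(Cup u, 0), (Cap, 0)]" 1 True]
    by (simp add: act.simps)
  also have "\<dots> = N [(Cup u, 0), (Cap, 0), (Cup u, 0), (Cap, 0)]"
    using conway_kinks_above_cup[OF N, of "[]" "[]" "[]" "\<not> u" 1 "[(Cap, 0), (Cup u, 0), (Cap, 0)]" True]
    by (simp add: act.simps)
  also have "\<dots> = N [(Cup u, 0), (Cup u, 2), (Cap, 0), (Cap, 0)]"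
    using conway_move[OF N move.commute[of 0 0 Cap "Cup u"], of "[(Cup u, 0)]" "[u, \<not> u]" "[u, \<not> u]" "[(Cap, 0)]"]
    by (simp add: act.simps numeral_2_eq_2)
  finally show ?thesis using L0 by simp
qed

fun continuant :: "(nat \<Rightarrow> int) \<Rightarrow> nat \<Rightarrow> int poly" where
  "continuant b 0 = 1"
| "continuant b (Suc 0) = [:0, b 0:]"
| "continuant b (Suc (Suc m)) = [:0, b (Suc m):] * continuant b (Suc m) + continuant b m"

text \<open>
  Smoothing a crossing of region \<open>m\<close> leaves a maximum and a minimum at the position of that
  region.  The minimum and one of the closing maxima form a zigzag, and straightening it leaves
  the top for the other parity.
\<close>

lemma conway_plat_cut_band:
  assumes N: "is_conway_polynomial N" and x: "x = (u = odd m)"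
  shows "N (plat_bottom u b m @ [(Cap, region_pos m), (Cup x, region_pos m)] @ plat_top (Suc m))
       = N (plat_bottom u b m @ plat_top m)"
proof (cases "even m")
  case True
  have "N ((plat_bottom u b m @ [(Cap, 1)]) @ [(Cup x, 0 + 1), (Cap, 0)] @ [(Cap, 0)])
      = N ((plat_bottom u b m @ [(Cap, 1)]) @ [] @ [(Cap, 0)])"
    using True x by (intro conway_move[OF N move.zigzag_left, where w = "[u, \<not> u]" and v = "[u, \<not> u]"])
      (auto simp: run_append run_plat_bottom act.simps)
  then show ?thesis
    using True by (simp add: plat_top_def region_pos_def)
next
  case False
  have "N ((plat_bottom u b m @ [(Cap, 0)]) @ [(Cup x, 0), (Cap, 0 + 1)] @ [(Cap, 0)])
      = N ((plat_bottom u b m @ [(Cap, 0)]) @ [] @ [(Cap, 0)])"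
    using False x by (intro conway_move[OF N move.zigzag_right, where w = "[u, \<not> u]" and v = "[u, \<not> u]"])
      (auto simp: run_append run_plat_bottom act.simps)
  then show ?thesis
    using False by (simp add: plat_top_def region_pos_def)
qed

text \<open>
  With the top of the wrong parity, the last region sits directly below a maximum.
\<close>

lemma conway_plat_untwist:
  assumes N: "is_conway_polynomial N"
  shows "N (plat_bottom u b (Suc m) @ plat_top m) = N (plat_bottom u b m @ plat_top m)"
proof -
  obtain w1 x w2 where w: "[u, \<not> u, u, \<not> u] = w1 @ [x, \<not> x] @ w2" "length w1 = region_pos m"
    and w': "w1 @ w2 = [u, \<not> u]"
    by (rule plat_state_split)
  have top: "plat_top m = [(Cap, length w1)] @ [(Cap, 0)]"
    by (simp add: w plat_top_def region_pos_def)
  show ?thesis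
    unfolding plat_bottom_Suc full_twists_def append_assoc w(2)[symmetric] top
  proof (rule conway_kinks_below_cap[OF N])
    show "run [] (plat_bottom u b m) = Some (w1 @ [x, \<not> x] @ w2)"
      by (simp only: run_plat_bottom w(1))
    show "run (w1 @ w2) [(Cap, 0)] = Some []"
      unfolding w' by (simp add: act.simps)
  qed
qed

lemma conway_plat_Suc:
  assumes N: "is_conway_polynomial N"
  shows "N (plat_bottom u b (Suc m) @ plat_top (Suc m))
      = [:0, b m:] * N (plat_bottom u b m @ plat_top m) + N (plat_bottom u b m @ plat_top (Suc m))"
proof -
  obtain w1 x w2 where w: "[u, \<not> u, u, \<not> u] = w1 @ [x, \<not> x] @ w2" "length w1 = region_pos m"
    and x: "x = (u = odd m)"
    by (rule plat_state_split)
  have "N (plat_bottom u b m @ full_twists (length w1) (b m) @ plat_top (Suc m))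
      = N (plat_bottom u b m @ plat_top (Suc m))
        + [:0, b m:] * N (plat_bottom u b m @ [(Cap, length w1), (Cup x, length w1)] @ plat_top (Suc m))"
    by (rule conway_full_twists[OF N run_plat_bottom[of u, unfolded w(1)]
          run_plat_top[of u, unfolded w(1)]])
  then show ?thesis
    unfolding w(2) conway_plat_cut_band[OF N x] by (simp add: plat_bottom_Suc)
qed

lemma conway_plat_0:
  assumes N: "is_conway_polynomial N"
  shows "N (plat_bottom u b 0 @ plat_top 0) = 1"
proof -
  have "N ([(Cup u, 0)] @ [(Cup u, 1 + 1), (Cap, 1)] @ [(Cap, 0)]) = N ([(Cup u, 0)] @ [] @ [(Cap, 0)])"
    by (rule conway_move[OF N move.zigzag_left, where w = "[u, \<not> u]" and v = "[u, \<not> u]"])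
      (auto simp: act.simps)
  then show ?thesis
    using conway_circle[OF N, of u] by (simp add: plat_bottom_def plat_top_def numeral_2_eq_2)
qed

text \<open>
  If the last region is emptied, the top has the parity that lets the region before it untwist;
  for \<open>m = 1\<close> there is no such region, and two split circles remain.
\<close>

lemma conway_plat:
  assumes N: "is_conway_polynomial N"
  shows "N (plat_bottom u b m @ plat_top m) = continuant b m"
proof (induction b m rule: continuant.induct)
  case (1 b)
  show ?case using conway_plat_0[OF N] by simp
next
  case (2 b)
  have "N (plat_bottom u b 0 @ plat_top (Suc 0)) = 0"
    using conway_two_circles[OF N] by (simp add: plat_bottom_def plat_top_def)
  moreover have "N (plat_bottom u b 0 @ plat_top 0) = 1"
    using conway_plat_0[OF N] .
  ultimately show ?case
    using conway_plat_Suc[OF N, of u b 0] by simp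
next
  case (3 b m)
  have "plat_top (Suc (Suc m)) = plat_top m"
    by (simp add: plat_top_def)
  with 3 show ?case
    using conway_plat_Suc[OF N, of u b "Suc m"] conway_plat_untwist[OF N, of u b m] by simp
qed

section \<open>Coefficients of continuants\<close>

text \<open>
  The sets covered by \<open>k\<close> disjoint dominoes, that is pairs \<open>{i, i + 1}\<close>, on the numbers below
  \<open>m\<close>.  Such a set determines its dominoes, since its maximal runs of consecutive numbers have
  even length; so sums over these sets are sums over the \<open>k\<close>-matchings of a path with \<open>m\<close>
  vertices.
\<close>

fun domino_covers :: "nat \<Rightarrow> nat \<Rightarrow> nat set set" where
  "domino_covers m 0 = {{}}"
| "domino_covers 0 (Suc k) = {}"
| "domino_covers (Suc 0) (Suc k) = {}"
| "domino_covers (Suc (Suc m)) (Suc k) =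
     domino_covers (Suc m) (Suc k) \<union> (\<lambda>C. insert m (insert (Suc m) C)) ` domino_covers m k"

lemma domino_covers_subset: "C \<in> domino_covers m k \<Longrightarrow> C \<subseteq> {..<m}"
proof (induction m k arbitrary: C rule: domino_covers.induct)
  case (4 m k)
  show ?case
  proof (cases "C \<in> domino_covers (Suc m) (Suc k)")
    case True
    then show ?thesis using "4.IH"(1)[of C] by (auto simp: subset_iff less_Suc_eq)
  next
    case False
    with "4.prems" obtain C' where "C' \<in> domino_covers m k" "C = insert m (insert (Suc m) C')"
      by auto
    then show ?thesis using "4.IH"(2)[of C'] by (auto simp: subset_iff less_Suc_eq)
  qed
qed auto

lemma finite_domino_covers [simp]: "finite (domino_covers m k)"
  by (induction m k rule: domino_covers.induct) auto

lemma domino_covers_empty: "m < 2 * k \<Longrightarrow> domino_covers m k = {}"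
  by (induction m k rule: domino_covers.induct) auto

text \<open>
  The two parts of the recursion are disjoint, as only the second one covers the last vertex.
\<close>

lemma sum_domino_covers_Suc:
  "(\<Sum>C\<in>domino_covers (Suc (Suc m)) (Suc k). f C)
   = (\<Sum>C\<in>domino_covers (Suc m) (Suc k). f C)
     + (\<Sum>C\<in>domino_covers m k. f (insert m (insert (Suc m) C)))"
proof -
  have "inj_on (\<lambda>C. insert m (insert (Suc m) C)) (domino_covers m k)"
  proof (rule inj_onI)
    fix C D
    assume "C \<in> domino_covers m k" "D \<in> domino_covers m k"
      and eq: "insert m (insert (Suc m) C) = insert m (insert (Suc m) D)"
    then have "m \<notin> C" "Suc m \<notin> C" "m \<notin> D" "Suc m \<notin> D"
      using domino_covers_subset by fastforce+
    with eq show "C = D" by (simp add: insert_ident)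
  qed
  moreover have "domino_covers (Suc m) (Suc k) \<inter> (\<lambda>C. insert m (insert (Suc m) C)) ` domino_covers m k = {}"
    using domino_covers_subset by fastforce
  ultimately show ?thesis
    by (simp add: sum.union_disjoint sum.reindex)
qed

lemma card_domino_covers: "card (domino_covers m k) = (m - k) choose k"
proof (induction m k rule: domino_covers.induct)
  case (4 m k)
  have "card (domino_covers (Suc (Suc m)) (Suc k))
      = (Suc m - Suc k choose Suc k) + (m - k choose k)"
    using sum_domino_covers_Suc[of "\<lambda>_. 1 :: nat" m k] 4 by simp
  then show ?case
    by (cases "m < k") (auto simp: Suc_diff_le not_less)
qed auto

lemma card_domino_covers_pascal:
  assumes "1 \<le> k" "2 * k \<le> m"
  shows "card (domino_covers m k) = ((m - k - 1) choose k) + ((m - k - 1) choose (k - 1))"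
proof -
  obtain n l where "k = Suc l" "m - k = Suc n"
    using assms by (metis Suc_le_D le_diff_conv2 add_leE mult_2 one_le_mult_iff One_nat_def le_trans)
  then show ?thesis by (simp add: card_domino_covers)
qed

text \<open>
  Deleting an interior vertex splits the path into two, and together they have at most as many
  \<open>k\<close>-matchings as the single path on the same number of vertices, which is what deleting an end
  vertex leaves.
\<close>

lemma card_domino_covers_avoiding:
  assumes "j < m"
  shows "card {C \<in> domino_covers m k. j \<notin> C} \<le> (m - 1 - k) choose k"
    and "j = 0 \<Longrightarrow> card {C \<in> domino_covers m k. j \<notin> C} = (m - 1 - k) choose k"
proof -
  define c where "c m k = (\<Sum>C\<in>domino_covers m k. if j \<notin> C then 1 else 0 :: nat)" for m k
  have card: "card {C \<in> domino_covers m k. j \<notin> C} = c m k" for m k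
    by (simp add: c_def sum.If_cases Int_def)
  have rec: "c (Suc (Suc m)) (Suc k) = c (Suc m) (Suc k) + (if j < m then c m k else 0)"
    if "j < Suc (Suc m)" for m k
    unfolding c_def sum_domino_covers_Suc using that by (auto intro!: sum.cong)
  have all: "c m k = card (domino_covers m k)" if "m \<le> j" for m k
  proof -
    have "j \<notin> C" if "C \<in> domino_covers m k" for C
      using domino_covers_subset[OF that] \<open>m \<le> j\<close> by auto
    then show ?thesis by (simp add: c_def)
  qed
  have pascal: "(m - k choose Suc k) = (m - Suc k choose Suc k) + (m - Suc k choose k)"
    if "0 < m" for m k :: nat
  proof (cases "m \<le> k")
    case False
    then have "m - k = Suc (m - Suc k)" by simp
    then show ?thesis by simp
  qed (use that in auto)
  have "c m k \<le> (m - 1 - k choose k) \<and> (j = 0 \<longrightarrow> c m k = (m - 1 - k choose k))"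
    using assms
  proof (induction m k rule: domino_covers.induct)
    case (4 m k)
    consider "j < m" | "j = m" | "j = Suc m" using "4.prems" by linarith
    then show ?case
    proof cases
      case 1
      then have "c (Suc m) (Suc k) \<le> (m - Suc k choose Suc k)" "c m k \<le> (m - Suc k choose k)"
        "j = 0 \<Longrightarrow> c (Suc m) (Suc k) = (m - Suc k choose Suc k)" "j = 0 \<Longrightarrow> c m k = (m - Suc k choose k)"
        using "4.IH" by simp_all
      moreover have "c (Suc (Suc m)) (Suc k) = c (Suc m) (Suc k) + c m k"
        using 1 by (simp add: rec)
      moreover have "Suc (Suc m) - 1 - Suc k = m - k" by simp
      ultimately show ?thesis
        using pascal[of m k] 1 by (metis add_mono less_nat_zero_code neq0_conv)
    next
      case 2
      then show ?thesis
        using 4 pascal[of m k] rec[of m k] by (cases "m = 0") (auto)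
    next
      case 3
      then show ?thesis by (simp add: rec all card_domino_covers)
    qed
  qed (auto simp: c_def)
  then show "card {C \<in> domino_covers m k. j \<notin> C} \<le> (m - 1 - k) choose k"
    and "j = 0 \<Longrightarrow> card {C \<in> domino_covers m k. j \<notin> C} = (m - 1 - k) choose k"
    unfolding card by blast+
qed

lemma continuant_top_coeff:
  "degree (continuant b m) \<le> m \<and> coeff (continuant b m) m = (\<Prod>i<m. b i)"
proof (induction b m rule: continuant.induct)
  case (2 b)
  then show ?case by (auto simp: degree_pCons_eq_if)
next
  case (3 b m)
  have "degree ([:0, b (Suc m):] * continuant b (Suc m)) \<le> 1 + Suc m"
    using 3 by (intro order_trans[OF degree_mult_le] add_mono) (auto simp: degree_pCons_eq_if)
  moreover have "coeff (continuant b m) (Suc (Suc m)) = 0"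
    using 3 by (intro coeff_eq_0) auto
  ultimately show ?case
    using 3 by (auto intro!: degree_add_le simp: mult_ac)
qed auto

text \<open>
  Euler's rule: the last entry either remains or is deleted together with the one before it.
\<close>

lemma coeff_continuant:
  "2 * k \<le> m \<Longrightarrow>
   coeff (continuant b m) (m - 2 * k) = (\<Sum>C\<in>domino_covers m k. \<Prod>i\<in>{..<m} - C. b i)"
proof (induction m k rule: domino_covers.induct)
  case (1 m)
  then show ?case by (simp add: continuant_top_coeff)
next
  case (4 m k)
  have "(\<Prod>i\<in>{..<Suc (Suc m)} - C. b i) = b (Suc m) * (\<Prod>i\<in>{..<Suc m} - C. b i)"
    if "C \<in> domino_covers (Suc m) (Suc k)" for C
  proof -
    have "{..<Suc (Suc m)} - C = insert (Suc m) ({..<Suc m} - C)"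
      using domino_covers_subset[OF that] by auto
    then show ?thesis by simp
  qed
  moreover have "{..<Suc (Suc m)} - insert m (insert (Suc m) C) = {..<m} - C" for C
    by auto
  ultimately have "(\<Sum>C\<in>domino_covers (Suc (Suc m)) (Suc k). \<Prod>i\<in>{..<Suc (Suc m)} - C. b i)
      = b (Suc m) * (\<Sum>C\<in>domino_covers (Suc m) (Suc k). \<Prod>i\<in>{..<Suc m} - C. b i)
        + (\<Sum>C\<in>domino_covers m k. \<Prod>i\<in>{..<m} - C. b i)"
    by (simp add: sum_domino_covers_Suc sum_distrib_left del: domino_covers.simps)
  also have "b (Suc m) * (\<Sum>C\<in>domino_covers (Suc m) (Suc k). \<Prod>i\<in>{..<Suc m} - C. b i)
      = coeff ([:0, b (Suc m):] * continuant b (Suc m)) (m - 2 * k)"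
    \<comment> \<open>If \<open>m = 2 k\<close>, the constant coefficient is meant: multiples of \<open>z\<close> do not contribute to it,
      and \<open>k + 1\<close> dominoes do not fit on \<open>m + 1\<close> vertices.\<close>
  proof (cases "m = 2 * k")
    case True
    then show ?thesis by (simp add: domino_covers_empty del: domino_covers.simps)
  next
    case False
    with 4 have "m - 2 * k = Suc (Suc m - 2 * Suc k)" "2 * Suc k \<le> Suc m" by auto
    then show ?thesis using "4.IH"(1) by (simp del: domino_covers.simps)
  qed
  finally show ?case
    using 4 by (simp del: domino_covers.simps)
qed auto

lemma degree_continuant:
  assumes "\<And>i. i < m \<Longrightarrow> b i \<noteq> 0"
  shows "degree (continuant b m) = m"
proof (rule antisym)
  have "coeff (continuant b m) m \<noteq> 0"
    using assms by (simp add: continuant_top_coeff)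
  then show "m \<le> degree (continuant b m)"
    by (rule le_degree)
qed (simp add: continuant_top_coeff)

section \<open>The bound for the coefficients\<close>

text \<open>Weierstrass' product inequality, in terms of the complements \<open>1 - x a\<close>.\<close>

lemma one_minus_prod_le_sum:
  fixes x :: "'a \<Rightarrow> real"
  assumes "finite F" "\<And>a. a \<in> F \<Longrightarrow> 0 \<le> x a" "\<And>a. a \<in> F \<Longrightarrow> x a \<le> 1"
  shows "1 - prod x F \<le> (\<Sum>a\<in>F. 1 - x a)"
  using assms
proof (induction F rule: finite_induct)
  case (insert a F)
  have "0 \<le> (1 - x a) * (1 - prod x F)"
    using insert.prems by (intro mult_nonneg_nonneg) (auto intro: prod_le_1)
  then show ?case
    using insert.IH insert.prems insert.hyps by (auto simp: algebra_simps)
qed simp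

text \<open>
  Exchanging the products, each \<open>a i\<close> occurs on the right as often as \<open>i\<close> is covered, hence at
  least once.
\<close>

lemma prod_le_prod_prod_cover:
  fixes a :: "'a \<Rightarrow> real"
  assumes fin: "finite V" "finite F" and a: "\<And>i. i \<in> V \<Longrightarrow> 1 \<le> a i"
    and F: "\<And>C. C \<in> F \<Longrightarrow> C \<subseteq> V" and cover: "V \<subseteq> \<Union>F"
  shows "(\<Prod>i\<in>V. a i) \<le> (\<Prod>C\<in>F. \<Prod>i\<in>C. a i)"
proof -
  have "(\<Prod>C\<in>F. \<Prod>i\<in>C. a i) = (\<Prod>C\<in>F. \<Prod>i\<in>V. if i \<in> C then a i else 1)"
  proof (rule prod.cong[OF refl])
    fix C assume "C \<in> F"
    then have "V \<inter> C = C" using F by blast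
    then show "(\<Prod>i\<in>C. a i) = (\<Prod>i\<in>V. if i \<in> C then a i else 1)"
      using fin by (simp add: prod.If_cases)
  qed
  also have "\<dots> = (\<Prod>i\<in>V. \<Prod>C\<in>F. if i \<in> C then a i else 1)"
    by (rule prod.swap)
  also have "\<dots> \<ge> (\<Prod>i\<in>V. a i)"
  proof (intro prod_mono conjI)
    fix i assume i: "i \<in> V"
    with cover obtain D where D: "D \<in> F" "i \<in> D" by auto
    have "1 \<le> (\<Prod>C\<in>F - {D}. if i \<in> C then a i else 1)"
      using a[OF i] by (intro prod_ge_1) auto
    then show "a i \<le> (\<Prod>C\<in>F. if i \<in> C then a i else 1)"
      using D a[OF i] fin by (simp add: prod.remove[OF _ D(1)] mult_left_mono[of 1 _ "a i", simplified])
    show "0 \<le> a i" using a[OF i] by simp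
  qed
  finally show ?thesis .
qed

text \<open>
  In the proof, \<open>w C\<close> is the factor 1 or \<open>g\<close> of the crude estimate \<open>w C * h\<close> for the term of \<open>C\<close>.
  The term is exactly \<open>w C * h / Q C\<close>, which falls short of the estimate by at least
  \<open>h * (1 - 1 / Q C)\<close>.  These savings add up to at least \<open>h - 1\<close>, since the sets \<open>C\<close> cover all
  indices.
\<close>

lemma cover_sum_bound:
  fixes b :: "nat \<Rightarrow> int"
  assumes k: "1 \<le> k" "2 * k \<le> m" and b: "\<And>i. i < m \<Longrightarrow> b i \<noteq> 0"
    and g: "0 < g" "int g dvd b j" and j: "j < m"
  shows "(\<Sum>C\<in>domino_covers m k. \<Prod>i\<in>{..<m} - C. real_of_int \<bar>b i\<bar>)
    \<le> (real ((m - k - 1) choose k) + 1 / real g * (real ((m - k - 1) choose (k - 1)) - 1))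
        * (\<Prod>i<m. real_of_int \<bar>b i\<bar>) + 1"
proof -
  let ?F = "domino_covers m k" and ?u = "(m - k - 1) choose k" and ?v = "(m - k - 1) choose (k - 1)"
  define a where "a i = real_of_int \<bar>b i\<bar> / (if i = j then real g else 1)" for i
  define h where "h = (\<Prod>i<m. a i)"
  define Q where "Q C = (\<Prod>i\<in>C. a i)" for C
  define w where "w C = (if j \<in> C then 1 else real g)" for C
  have a1: "1 \<le> a i" if "i < m" for i
  proof -
    have "int g \<le> \<bar>b i\<bar>" if "i = j"
      using that g b[OF \<open>i < m\<close>] dvd_imp_le_int[of "b i" "int g"] by simp
    then have "real g \<le> real_of_int \<bar>b i\<bar>" if "i = j"
      using that by (metis of_int_le_iff of_int_of_nat_eq)
    then show ?thesis
      using b[OF that] g by (auto simp: a_def)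
  qed
  have sub: "C \<subseteq> {..<m}" if "C \<in> ?F" for C
    using domino_covers_subset that .
  have h1: "1 \<le> h"
    unfolding h_def using a1 by (intro prod_ge_1) auto
  have Q1: "1 \<le> Q C" if "C \<in> ?F" for C
    unfolding Q_def using a1 sub[OF that] by (intro prod_ge_1) auto
  have g1: "1 \<le> real g" using g by simp
  have absb: "real_of_int \<bar>b i\<bar> = (if i = j then real g else 1) * a i" for i
    using g by (simp add: a_def)
  have whole: "(\<Prod>i<m. real_of_int \<bar>b i\<bar>) = real g * h"
    unfolding absb prod.distrib h_def using j by simp
  have Term: "(\<Prod>i\<in>{..<m} - C. real_of_int \<bar>b i\<bar>) = w C * h / Q C" if "C \<in> ?F" for C
  proof -
    have "h = (\<Prod>i\<in>{..<m} - C. a i) * Q C"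
      unfolding h_def Q_def using sub[OF that] by (subst prod.subset_diff[of C]) auto
    moreover have "(\<Prod>i\<in>{..<m} - C. real_of_int \<bar>b i\<bar>) = w C * (\<Prod>i\<in>{..<m} - C. a i)"
      unfolding absb prod.distrib w_def using j by simp
    ultimately show ?thesis using Q1[OF that] by simp
  qed
  have "(\<Sum>C\<in>?F. \<Prod>i\<in>{..<m} - C. real_of_int \<bar>b i\<bar>)
      \<le> (\<Sum>C\<in>?F. h * w C - h * (1 - 1 / Q C))"
  proof (rule sum_mono)
    fix C assume C: "C \<in> ?F"
    have "0 \<le> (w C - 1) * (h * (1 - 1 / Q C))"
      using Q1[OF C] h1 g1 by (intro mult_nonneg_nonneg) (auto simp: w_def)
    then show "(\<Prod>i\<in>{..<m} - C. real_of_int \<bar>b i\<bar>) \<le> h * w C - h * (1 - 1 / Q C)"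
      unfolding Term[OF C] by (simp add: algebra_simps diff_divide_distrib)
  qed
  also have "\<dots> = h * (\<Sum>C\<in>?F. w C) - h * (\<Sum>C\<in>?F. 1 - 1 / Q C)"
    by (subst sum_subtractf) (simp only: sum_distrib_left)
  also have "\<dots> \<le> h * (real g * real ?u + real ?v) - h * (1 - 1 / h)"
  proof -
    let ?U = "card {C \<in> ?F. j \<notin> C}"
    have "card ?F = ?u + ?v"
      by (rule card_domino_covers_pascal[OF k])
    then have "(\<Sum>C\<in>?F. w C) = real ?u + real ?v + (real g - 1) * real ?U"
    proof -
      have "(\<Sum>C\<in>?F. w C) = (\<Sum>C\<in>?F. 1 + (real g - 1) * (if j \<notin> C then 1 else 0))"
        by (intro sum.cong) (auto simp: w_def)
      also have "\<dots> = real (card ?F) + (real g - 1) * real ?U"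
        by (simp add: sum.distrib sum_distrib_left[symmetric] sum.If_cases Int_def)
      finally show ?thesis using \<open>card ?F = _\<close> by simp
    qed
    moreover have "(real g - 1) * real ?U \<le> (real g - 1) * real ?u"
      using card_domino_covers_avoiding(1)[OF j, of k] g1 by (intro mult_left_mono) (auto simp: diff_commute)
    ultimately have 1: "(\<Sum>C\<in>?F. w C) \<le> real g * real ?u + real ?v"
      by (simp add: algebra_simps)
    have "{..<m} \<subseteq> \<Union>?F"
    proof
      fix i assume i: "i \<in> {..<m}"
      have "0 < ?v" using k by simp
      moreover have "card {C \<in> ?F. i \<notin> C} \<le> ?u"
        using card_domino_covers_avoiding(1)[of i m k] i by (simp add: diff_commute)
      ultimately have "card {C \<in> ?F. i \<notin> C} < card ?F"
        using \<open>card ?F = _\<close> by linarith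
      then have "{C \<in> ?F. i \<notin> C} \<noteq> ?F" by (metis less_irrefl)
      then show "i \<in> \<Union>?F" by blast
    qed
    then have "h \<le> (\<Prod>C\<in>?F. Q C)"
      unfolding h_def Q_def using a1 sub by (intro prod_le_prod_prod_cover) auto
    then have "1 - 1 / h \<le> 1 - (\<Prod>C\<in>?F. 1 / Q C)"
      using h1 by (simp add: prod_dividef frac_le)
    also have "\<dots> \<le> (\<Sum>C\<in>?F. 1 - 1 / Q C)"
    proof (rule one_minus_prod_le_sum)
      fix C assume "C \<in> ?F"
      from Q1[OF this] show "0 \<le> 1 / Q C" "1 / Q C \<le> 1" by simp_all
    qed simp
    finally have "1 - 1 / h \<le> (\<Sum>C\<in>?F. 1 - 1 / Q C)" .
    with 1 show ?thesis
      using h1 by (intro diff_mono mult_left_mono) auto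
  qed
  also have "\<dots> = (real ?u + 1 / real g * (real ?v - 1)) * (\<Prod>i<m. real_of_int \<bar>b i\<bar>) + 1"
    unfolding whole using h1 g1 by (simp add: field_simps)
  finally show ?thesis .
qed

lemma continuant_bound:
  assumes k: "1 \<le> k" "2 * k \<le> m" and b: "\<And>i. i < m \<Longrightarrow> b i \<noteq> 0"
    and g: "0 < g" "int g dvd b j" and j: "j < m"
  shows "real_of_int \<bar>coeff (continuant b m) (m - 2 * k)\<bar>
    \<le> (real ((m - k - 1) choose k) + 1 / real g * (real ((m - k - 1) choose (k - 1)) - 1))
        * real_of_int \<bar>\<Prod>i<m. b i\<bar> + 1"
proof -
  have "real_of_int \<bar>coeff (continuant b m) (m - 2 * k)\<bar>
      \<le> (\<Sum>C\<in>domino_covers m k. \<Prod>i\<in>{..<m} - C. real_of_int \<bar>b i\<bar>)"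
    unfolding coeff_continuant[OF k(2)] by (simp flip: of_int_abs abs_prod of_int_prod of_int_sum)
  also note cover_sum_bound[where b = b, OF k b g j]
  finally show ?thesis by (simp add: abs_prod)
qed

section \<open>The extremal continuants\<close>

text \<open>
  A domino on \<open>m\<close> and \<open>m + 1\<close> contributes the odd power \<open>e ^ (2 * m + 1) = e\<close>, wherever it lies.
\<close>

lemma domino_cover_sign:
  fixes e :: int
  assumes "e = 1 \<or> e = - 1" and "C \<in> domino_covers m k"
  shows "(\<Prod>i\<in>C. e ^ i) = e ^ k"
  using assms(2)
proof (induction m k arbitrary: C rule: domino_covers.induct)
  case (4 m k)
  then show ?case
  proof (cases "C \<in> domino_covers (Suc m) (Suc k)")
    case False
    with "4.prems" obtain C' where C': "C' \<in> domino_covers m k" "C = insert m (insert (Suc m) C')"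
      by auto
    moreover have "finite C'" "m \<notin> C'" "Suc m \<notin> C'"
      using domino_covers_subset[OF C'(1)] by (auto intro: finite_subset)
    ultimately show ?thesis
      using "4.IH"(2)[of C'] assms(1) by (auto simp: power_add)
  qed (use "4.IH"(1) in blast)
qed auto

lemma continuant_extremal:
  fixes e :: int
  assumes e: "e = 1 \<or> e = - 1" and k: "1 \<le> k" "2 * k \<le> m"
    and b: "\<And>i. i < m \<Longrightarrow> b i = (if i = 0 then int g else e ^ i)"
  shows "\<bar>coeff (continuant b m) (m - 2 * k)\<bar>
    = int (((m - k - 1) choose k) * g + ((m - k - 1) choose (k - 1)))"
proof -
  let ?F = "domino_covers m k"
  have m: "0 < m" using k by simp
  have "(\<Prod>i\<in>{..<m} - C. b i) = e ^ k * (\<Prod>i<m. e ^ i) * (if 0 \<notin> C then int g else 1)"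
    if C: "C \<in> ?F" for C
  proof -
    have "(\<Prod>i<m. e ^ i) = (\<Prod>i\<in>{..<m} - C. e ^ i) * (\<Prod>i\<in>C. e ^ i)"
      using domino_covers_subset[OF C] by (intro prod.subset_diff) auto
    also have "(\<Prod>i\<in>C. e ^ i) = e ^ k"
      by (rule domino_cover_sign[OF e C])
    finally have "e ^ k * (\<Prod>i<m. e ^ i) = (\<Prod>i\<in>{..<m} - C. e ^ i)"
      using e by (auto simp: power_add[symmetric])
    moreover have "(\<Prod>i\<in>{..<m} - C. b i) = (\<Prod>i\<in>{..<m} - C. (if i = 0 then int g else 1) * e ^ i)"
      using b by (intro prod.cong) auto
    ultimately show ?thesis
      using m by (simp add: prod.distrib)
  qed
  then have "coeff (continuant b m) (m - 2 * k)
      = e ^ k * (\<Prod>i<m. e ^ i) * (\<Sum>C\<in>?F. if 0 \<notin> C then int g else 1)"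
    unfolding coeff_continuant[OF k(2)] by (simp add: sum_distrib_left)
  moreover have "\<bar>e ^ k * (\<Prod>i<m. e ^ i)\<bar> = 1"
    using e by (auto simp: abs_mult abs_prod power_abs)
  ultimately have "\<bar>coeff (continuant b m) (m - 2 * k)\<bar> = \<bar>\<Sum>C\<in>?F. if 0 \<notin> C then int g else 1\<bar>"
    by (simp add: abs_mult)
  also have "(\<Sum>C\<in>?F. if 0 \<notin> C then int g else 1)
      = int g * int (card {C \<in> ?F. 0 \<notin> C}) + int (card {C \<in> ?F. 0 \<in> C})"
    by (simp add: sum.If_cases Int_def)
  also have "card {C \<in> ?F. 0 \<notin> C} = (m - k - 1) choose k"
    using card_domino_covers_avoiding(2)[OF m] by (simp add: diff_commute)
  also have "card {C \<in> ?F. 0 \<in> C} = (m - k - 1) choose (k - 1)"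
  proof -
    have "card ?F = card {C \<in> ?F. 0 \<notin> C} + card {C \<in> ?F. 0 \<in> C}"
      by (subst card_Un_disjoint[symmetric]) (auto intro: arg_cong[of _ _ card])
    moreover have "card ?F = ((m - k - 1) choose k) + ((m - k - 1) choose (k - 1))"
      by (rule card_domino_covers_pascal[OF k])
    ultimately show ?thesis
      using card_domino_covers_avoiding(2)[OF m, of k] by (simp add: diff_commute)
  qed
  finally show ?thesis by (simp add: mult.commute)
qed

section \<open>The greatest prime divisor\<close>

text \<open>
  A prime that divides the product divides a factor, and if the product is \<open>\<plusminus>1\<close>, the conventional
  value 1 divides every factor.
\<close>

lemma greatest_prime_divisor_prod:
  fixes b :: "nat \<Rightarrow> int"
  assumes b: "\<And>i. i < m \<Longrightarrow> b i \<noteq> 0" and m: "0 < m"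
  obtains j where "j < m" "int (greatest_prime_divisor (\<Prod>i<m. b i)) dvd b j"
    "0 < greatest_prime_divisor (\<Prod>i<m. b i)"
proof (cases "\<bar>\<Prod>i<m. b i\<bar> = 1")
  case True
  with that[of 0] m show ?thesis by (simp add: greatest_prime_divisor_def)
next
  case False
  let ?c = "\<Prod>i<m. b i" and ?S = "{p :: nat. prime p \<and> int p dvd (\<Prod>i<m. b i)}"
  have c0: "?c \<noteq> 0" using b by simp
  have "?S \<subseteq> {..nat \<bar>?c\<bar>}"
  proof
    fix p assume "p \<in> ?S"
    then have "int p dvd ?c" by simp
    then have "int p \<le> \<bar>?c\<bar>" using dvd_imp_le_int[OF c0] by fastforce
    then show "p \<in> {..nat \<bar>?c\<bar>}" by simp
  qed
  then have fin: "finite ?S" by (rule finite_subset) simp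
  have "nat \<bar>?c\<bar> \<noteq> 1" using False by simp
  then obtain p where "prime p" "p dvd nat \<bar>?c\<bar>" using prime_factor_nat by blast
  then have "?S \<noteq> {}" by auto
  with fin have "Max ?S \<in> ?S" by (rule Max_in)
  moreover have G: "greatest_prime_divisor ?c = Max ?S"
    using False by (simp add: greatest_prime_divisor_def)
  ultimately have "prime (greatest_prime_divisor ?c)" "int (greatest_prime_divisor ?c) dvd ?c"
    by auto
  moreover from this obtain j where "j < m" "int (greatest_prime_divisor ?c) dvd b j"
    using prime_dvd_prod_iff[of "{..<m}" "int (greatest_prime_divisor ?c)" b] by auto
  ultimately show ?thesis using that prime_gt_0_nat by blast
qed

lemma greatest_prime_divisor_prime:
  assumes "g = 1 \<or> prime g" and "\<bar>c\<bar> = int g"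
  shows "greatest_prime_divisor c = g"
proof (cases "g = 1")
  case False
  with assms(1) have g: "prime g" by simp
  have "{p. prime p \<and> int p dvd c} = {p. prime p \<and> p dvd g}"
    using assms(2) by (metis dvd_abs_iff int_dvd_int_iff)
  also have "\<dots> = {g}"
    using g by (auto simp: primes_dvd_imp_eq)
  finally show ?thesis
    using False assms(2) by (simp add: greatest_prime_divisor_def)
qed (use assms in \<open>simp add: greatest_prime_divisor_def\<close>)

section \<open>The sharp bound for two-bridge links\<close>

lemma link_diagram_plat: "link_diagram (plat_bottom u b m @ plat_top m)"
  by (simp add: link_diagram_def run_append run_plat_bottom run_plat_top)

lemma conway_polynomial_C:
  assumes N: "is_conway_polynomial N"
    and L: "is_C L (map (\<lambda>j. (-1) ^ j * (2 * b j)) [0..<m])"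
  shows "N L = continuant b m"
proof -
  obtain u where "link_diagram L" "isotopic L (plat_bottom u b m @ plat_top m)"
    using L unfolding is_C_def conway_form_plat by blast
  then have "N L = N (plat_bottom u b m @ plat_top m)"
    using N link_diagram_plat unfolding is_conway_polynomial_def by blast
  then show ?thesis
    by (simp add: conway_plat[OF N])
qed

theorem theorem4p4:
  fixes nabla :: "diagram \<Rightarrow> int poly"
  assumes "is_conway_polynomial nabla"
  shows
    "(\<forall>(L :: diagram) (m :: nat) (k :: nat) (c :: nat \<Rightarrow> int) (g :: nat).
        two_bridge L \<and> degree (nabla L) = m \<and> c = coeff (nabla L) \<and>
        g = greatest_prime_divisor (c m) \<and> 2 \<le> 2 * k \<and> 2 * k \<le> m \<longrightarrow>
        real_of_int \<bar>c (m - 2 * k)\<bar> \<le>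
          (real ((m - k - 1) choose k) + 1 / real g * (real ((m - k - 1) choose (k - 1)) - 1))
            * real_of_int \<bar>c m\<bar> + 1) \<and>
     (\<forall>(L :: diagram) (m :: nat) (k :: nat) (c :: nat \<Rightarrow> int) (g :: nat).
        (g = 1 \<or> prime g) \<and> 2 \<le> 2 * k \<and> 2 * k \<le> m \<and>
        (is_C L (2 * int g # replicate (m - 1) 2) \<or>
         is_C L (2 * int g # map (\<lambda>j. (-1) ^ j * 2) [1..<m])) \<and>
        c = coeff (nabla L) \<longrightarrow>
        two_bridge L \<and> degree (nabla L) = m \<and> g = greatest_prime_divisor (c m) \<and>
        real_of_int \<bar>c (m - 2 * k)\<bar> =
          (real ((m - k - 1) choose k) + 1 / real g * (real ((m - k - 1) choose (k - 1)) - 1))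
            * real_of_int \<bar>c m\<bar> + 1)"
proof -
  note N = assms
  have bound: "real_of_int \<bar>coeff (nabla L) (m - 2 * k)\<bar> \<le>
      (real ((m - k - 1) choose k) + 1 / real g * (real ((m - k - 1) choose (k - 1)) - 1))
        * real_of_int \<bar>coeff (nabla L) m\<bar> + 1"
    if L: "two_bridge L" and m: "degree (nabla L) = m"
      and g: "g = greatest_prime_divisor (coeff (nabla L) m)" and k: "2 \<le> 2 * k" "2 * k \<le> m"
    for L m k g
  proof -
    obtain bs where bs: "0 \<notin> set bs" "is_C L (map (\<lambda>j. (-1) ^ j * (2 * bs ! j)) [0..<length bs])"
      using L unfolding two_bridge_def by blast
    define b where "b j = bs ! j" for j
    have nabla: "nabla L = continuant b (length bs)"
      using conway_polynomial_C[OF N bs(2)] by (simp add: b_def[abs_def])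
    have b: "b i \<noteq> 0" if "i < length bs" for i
      using bs(1) that nth_mem by (fastforce simp: b_def)
    have len: "m = length bs"
      using degree_continuant[of "length bs" b] b m nabla by simp
    have top: "coeff (nabla L) m = (\<Prod>i<m. b i)"
      using continuant_top_coeff nabla len by simp
    obtain j where "j < m" "int (greatest_prime_divisor (\<Prod>i<m. b i)) dvd b j"
      "0 < greatest_prime_divisor (\<Prod>i<m. b i)"
      by (rule greatest_prime_divisor_prod[of m b]) (use b len k in auto)
    then have "j < m" "int g dvd b j" "0 < g"
      unfolding g top by simp_all
    then show ?thesis
      using continuant_bound[where b = b and m = m and k = k and g = g and j = j] k b len
      unfolding top by (simp add: nabla)
  qed
  have sharp: "two_bridge L \<and> degree (nabla L) = m \<and> g = greatest_prime_divisor (coeff (nabla L) m) \<and>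
      real_of_int \<bar>coeff (nabla L) (m - 2 * k)\<bar> =
      (real ((m - k - 1) choose k) + 1 / real g * (real ((m - k - 1) choose (k - 1)) - 1))
        * real_of_int \<bar>coeff (nabla L) m\<bar> + 1"
    if g: "g = 1 \<or> prime g" and k: "2 \<le> 2 * k" "2 * k \<le> m"
      and L: "is_C L (2 * int g # replicate (m - 1) 2) \<or>
         is_C L (2 * int g # map (\<lambda>j. (-1) ^ j * 2) [1..<m])"
    for L m k g
  proof -
    \<comment> \<open>In terms of the signed numbers of full twists, the two forms are \<open>(g, -1, 1, -1, \<dots>)\<close> and
      \<open>(g, 1, 1, 1, \<dots>)\<close>, that is \<open>(g, e, e\<^sup>2, \<dots>)\<close> with \<open>e = -1\<close> and \<open>e = 1\<close>.\<close>
    have form: "2 * int g # map (\<lambda>j. (-1) ^ j * (2 * e ^ j)) [1..<m]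
        = map (\<lambda>j. (-1) ^ j * (2 * (if j = 0 then int g else e ^ j))) [0..<m]" for e
      using k by (simp add: upt_conv_Cons)
    have "(-1) ^ j * (2 * (-1) ^ j) = (2 :: int)" for j :: nat
      by (cases "even j") simp_all
    then have twos: "replicate (m - 1) 2 = map (\<lambda>j. (-1) ^ j * (2 * (-1) ^ j) :: int) [1..<m]"
      by (simp only: map_replicate_const length_upt)
    obtain e :: int where e: "e = 1 \<or> e = -1"
      and Le: "is_C L (2 * int g # map (\<lambda>j. (-1) ^ j * (2 * e ^ j)) [1..<m])"
      using L
    proof
      assume "is_C L (2 * int g # replicate (m - 1) 2)"
      then show ?thesis using that[of "-1"] unfolding twos by blast
    next
      assume "is_C L (2 * int g # map (\<lambda>j. (-1) ^ j * 2) [1..<m])"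
      then show ?thesis using that[of 1] by simp
    qed
    define b where "b i = (if i = 0 then int g else e ^ i)" for i
    have g0: "0 < g" using g prime_gt_0_nat by auto
    have b0: "b i \<noteq> 0" for i
      using e g0 by (auto simp: b_def)
    have C: "is_C L (map (\<lambda>j. (-1) ^ j * (2 * b j)) [0..<m])"
      using Le unfolding form b_def .
    moreover have "map (\<lambda>j. (-1) ^ j * (2 * map b [0..<m] ! j)) [0..<length (map b [0..<m])]
        = map (\<lambda>j. (-1) ^ j * (2 * b j)) [0..<m]"
      by (rule nth_equalityI) simp_all
    ultimately have "is_C L (map (\<lambda>j. (-1) ^ j * (2 * map b [0..<m] ! j)) [0..<length (map b [0..<m])])"
      by (simp only:)
    then have tb: "two_bridge L"
      unfolding two_bridge_def using b0 by (intro exI[of _ "map b [0..<m]"]) auto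
    have nabla: "nabla L = continuant b m"
      by (rule conway_polynomial_C[OF N C])
    have "(\<Prod>i<m. \<bar>b i\<bar>) = int g"
    proof -
      have "(\<Prod>i<m. \<bar>b i\<bar>) = (\<Prod>i<m. if i = 0 then int g else 1)"
        using e by (intro prod.cong) (auto simp: b_def power_abs)
      then show ?thesis using k by simp
    qed
    then have top: "\<bar>coeff (nabla L) m\<bar> = int g"
      by (simp add: nabla continuant_top_coeff abs_prod)
    have deg: "degree (nabla L) = m"
      unfolding nabla using b0 by (intro degree_continuant)
    have "\<bar>coeff (nabla L) (m - 2 * k)\<bar>
        = int (((m - k - 1) choose k) * g + ((m - k - 1) choose (k - 1)))"
      unfolding nabla using k by (intro continuant_extremal[OF e]) (auto simp: b_def)
    then have "real_of_int \<bar>coeff (nabla L) (m - 2 * k)\<bar>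
        = real ((m - k - 1) choose k) * real g + real ((m - k - 1) choose (k - 1))"
      by simp
    also have "\<dots> = (real ((m - k - 1) choose k) + 1 / real g * (real ((m - k - 1) choose (k - 1)) - 1))
        * real_of_int \<bar>coeff (nabla L) m\<bar> + 1"
      unfolding top using g0 by (simp add: field_simps)
    finally show ?thesis
      using tb deg greatest_prime_divisor_prime[OF g top] by simp
  qed
  show ?thesis
    using bound sharp by blast
qed

end
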